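(* Let $\mathcal{C}$ be the class of finite simple connected planar graphs (given with a plane embedding) whose dual graph is also a simple connected planar graph. Taking the dual does not preserve twin-width: there exists $G\in\mathcal{C}$ such that $\mathrm{tww}(G)\neq \mathrm{tww}(G^* )$, where $G^*$ is the dual graph of $G$.
   Context: The dual graph $G^*$ of a plane graph $G$ has one vertex for each face of $G$, and an edge for each edge of $G$ joining the (vertices corresponding to the) two faces on either side of that edge (a loop if the same face lies on both sides). Twin-width: a trigraph is a vertex set with two disjoint sets of edges, black and red. Contracting two distinct vertices $u,v$ replaces them by a new vertex $w$; each $x\ne u,v$ adjacent to exactly one of $u,v$ is joined to $w$ by a red edge; each $x$ adjacent to both is joined to $w$ by a black edge if $ux,vx$ are both black and by a red edge otherwise; other edges are unchanged. A simple graph is a trigraph with no red edges. A $d$-sequence for an $n$-vertex graph $G$ is a sequence $G=G_n,\dots,G_1$ of trigraphs, each obtained from the previous by one contraction, with every vertex of every $G_i$ incident to at most $d$ red edges; $\mathrm{tww}(G)$ is the least such $d$. *)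

theory Defs
  imports "HOL-Analysis.Analysis"
begin

text \<open>Undirected multigraphs: an edge \<open>e\<close> with \<open>ends G e = {u, v}\<close> joins \<open>u\<close> and \<open>v\<close>;
  it is a loop when \<open>ends G e\<close> is a singleton.\<close>

record ('v, 'e) mgraph =
  verts :: "'v set"
  edges :: "'e set"
  ends :: "'e \<Rightarrow> 'v set"

definition simple_mgraph :: "('v, 'e) mgraph \<Rightarrow> bool" where
  "simple_mgraph G \<longleftrightarrow>
     finite (verts G) \<and> finite (edges G) \<and>
     (\<forall>e\<in>edges G. ends G e \<subseteq> verts G \<and> card (ends G e) = 2) \<and>
     inj_on (ends G) (edges G)"

definition connected_mgraph :: "('v, 'e) mgraph \<Rightarrow> bool" where
  "connected_mgraph G \<longleftrightarrow>
     verts G \<noteq> {} \<and>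
     (\<forall>u\<in>verts G. \<forall>v\<in>verts G. (u, v) \<in> {(x, y). \<exists>e\<in>edges G. ends G e = {x, y}}\<^sup>*)"

definition iso_mgraph :: "('v, 'e) mgraph \<Rightarrow> ('w, 'f) mgraph \<Rightarrow> bool" where
  "iso_mgraph G H \<longleftrightarrow>
     (\<exists>\<phi> \<psi>. bij_betw \<phi> (verts G) (verts H) \<and> bij_betw \<psi> (edges G) (edges H) \<and>
            (\<forall>e\<in>edges G. ends H (\<psi> e) = \<phi> ` ends G e))"

text \<open>A plane graph consists of a finite set \<open>V\<close> of points of the plane and a finite set \<open>E\<close> of
  curves. As the interior of an edge contains no vertex, the ends of an edge \<open>e\<close> are the points of
  \<open>e \<inter> V\<close>. A simple path may be closed, so loops are allowed here, and so are parallel edges.\<close>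

definition plane_graph :: "complex set \<Rightarrow> complex set set \<Rightarrow> bool" where
  "plane_graph V E \<longleftrightarrow>
     finite V \<and> finite E \<and>
     (\<forall>e\<in>E. \<exists>g. simple_path g \<and> path_image g = e \<and> e \<inter> V = {pathstart g, pathfinish g}) \<and>
     (\<forall>e\<in>E. \<forall>e'\<in>E. e \<noteq> e' \<longrightarrow> e \<inter> e' \<subseteq> V)"

definition plane_mgraph :: "complex set \<Rightarrow> complex set set \<Rightarrow> (complex, complex set) mgraph" where
  "plane_mgraph V E = \<lparr>verts = V, edges = E, ends = (\<lambda>e. e \<inter> V)\<rparr>"

definition planar_mgraph :: "('v, 'e) mgraph \<Rightarrow> bool" where
  "planar_mgraph G \<longleftrightarrow> (\<exists>V E. plane_graph V E \<and> iso_mgraph G (plane_mgraph V E))"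

definition faces :: "complex set \<Rightarrow> complex set set \<Rightarrow> complex set set" where
  "faces V E = components (- (V \<union> \<Union>E))"

text \<open>The faces on the two sides of an edge \<open>e\<close> are the faces having \<open>e\<close> on their frontier; there
  is only one such face, hence a loop, when both sides of \<open>e\<close> belong to the same face.\<close>

definition dual_mgraph :: "complex set \<Rightarrow> complex set set \<Rightarrow> (complex set, complex set) mgraph" where
  "dual_mgraph V E =
     \<lparr>verts = faces V E, edges = E, ends = (\<lambda>e. {f \<in> faces V E. e \<subseteq> frontier f})\<rparr>"

definition simple_dual_class :: "(complex set \<times> complex set set) set" where
  "simple_dual_class =
     {(V, E). plane_graph V E \<and>
        simple_mgraph (plane_mgraph V E) \<and> connected_mgraph (plane_mgraph V E) \<and>
        simple_mgraph (dual_mgraph V E) \<and> connected_mgraph (dual_mgraph V E) \<and>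
        planar_mgraph (dual_mgraph V E)}"

record 'a trigraph =
  tverts :: "'a set"
  black :: "'a set set"
  red :: "'a set set"

definition is_trigraph :: "'a trigraph \<Rightarrow> bool" where
  "is_trigraph T \<longleftrightarrow>
     finite (tverts T) \<and> black T \<inter> red T = {} \<and>
     (\<forall>e\<in>black T \<union> red T. e \<subseteq> tverts T \<and> card e = 2)"

definition tadj :: "'a trigraph \<Rightarrow> 'a \<Rightarrow> 'a \<Rightarrow> bool" where
  "tadj T x y \<longleftrightarrow> {x, y} \<in> black T \<union> red T"

definition contract :: "'a trigraph \<Rightarrow> 'a \<Rightarrow> 'a \<Rightarrow> 'a \<Rightarrow> 'a trigraph" where
  "contract T u v w =
     (let X = tverts T - {u, v} in
      \<lparr>tverts = insert w X,
       black = {e \<in> black T. u \<notin> e \<and> v \<notin> e} \<union>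
         {{w, x} |x. x \<in> X \<and> {u, x} \<in> black T \<and> {v, x} \<in> black T},
       red = {e \<in> red T. u \<notin> e \<and> v \<notin> e} \<union>
         {{w, x} |x. x \<in> X \<and> tadj T u x \<noteq> tadj T v x} \<union>
         {{w, x} |x. x \<in> X \<and> tadj T u x \<and> tadj T v x \<and>
                     \<not> ({u, x} \<in> black T \<and> {v, x} \<in> black T)}\<rparr>)"

text \<open>The new vertex \<open>w\<close> has to differ from all remaining vertices; the names \<open>u\<close> and \<open>v\<close>, which
  are no longer in use, may be recycled.\<close>

definition contracts_to :: "'a trigraph \<Rightarrow> 'a trigraph \<Rightarrow> bool" where
  "contracts_to T T' \<longleftrightarrow>
     (\<exists>u v w. u \<in> tverts T \<and> v \<in> tverts T \<and> u \<noteq> v \<and> w \<notin> tverts T - {u, v} \<and>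
              T' = contract T u v w)"

definition red_degree :: "'a trigraph \<Rightarrow> 'a \<Rightarrow> nat" where
  "red_degree T x = card {e \<in> red T. x \<in> e}"

text \<open>\<open>S i\<close> is the \<open>i\<close>-vertex trigraph of the sequence; the values of \<open>S\<close> outside
  \<open>{1..n}\<close> are irrelevant.\<close>

definition d_sequence :: "nat \<Rightarrow> 'a trigraph \<Rightarrow> (nat \<Rightarrow> 'a trigraph) \<Rightarrow> bool" where
  "d_sequence d T S \<longleftrightarrow>
     (let n = card (tverts T) in
      S n = T \<and>
      (\<forall>i\<in>{1..n}. is_trigraph (S i) \<and> (\<forall>x\<in>tverts (S i). red_degree (S i) x \<le> d)) \<and>
      (\<forall>i\<in>{1..<n}. contracts_to (S (Suc i)) (S i)))"

definition trigraph_of :: "('v, 'e) mgraph \<Rightarrow> 'v trigraph" where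
  "trigraph_of G = \<lparr>tverts = verts G, black = ends G ` edges G, red = {}\<rparr>"

text \<open>Meaningful for simple graphs only: \<open>trigraph_of\<close> identifies parallel edges.\<close>

definition tww :: "('v, 'e) mgraph \<Rightarrow> nat" where
  "tww G = (LEAST d. \<exists>S. d_sequence d (trigraph_of G) S)"

end

theory Submission
  imports Defs
begin

text \<open>The triangular bipyramid \<open>K\<^sub>5 - e\<close> has as dual the triangular prism. In the bipyramid one can
  repeatedly contract twins: first the two apexes, then any two vertices of the remaining \<open>K\<^sub>4\<close>; no
  red edge ever appears, so the twin-width is 0. The prism has no pair of twins, so the very first
  contraction creates a red edge and the twin-width is positive. The bipyramid is drawn with
  straight edges; each bounded face is an intersection, and the outer face a union, of three open
  half-planes.\<close>

text \<open>Faces and the two sides of an edge are defined through components and frontiers, so the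
  dual has to be computed topologically rather than read off a combinatorial embedding. This is
  where straight edges pay off: membership in an edge or in a face becomes a set of linear
  conditions on \<open>Re z\<close> and \<open>Im z\<close>. Six disjoint connected open sets that
  fill the complement of the drawing must be its faces, so neither the Jordan curve theorem nor
  Euler's formula is invoked. A simple dual rules out bridges and two-edge cuts, hence vertices of
  degree at most 2 in any larger example. The smaller candidates, K_4 and the wheel with four
  spokes, are self-dual; the bipyramid comes next.\<close>

section \<open>Components, frontiers and isomorphisms\<close>

text \<open>If a connected \<open>D\<close> contains \<open>U\<close> and stays inside the union,
  then \<open>U\<close> and the union of the other members are disjoint open sets covering
  \<open>D\<close>, so \<open>D\<close> misses the others. This turns an explicit list of sets into
  the list of faces.\<close>

lemma components_Union_open_disjoint:
  assumes "\<And>U. U \<in> \<U> \<Longrightarrow> open U \<and> connected U \<and> U \<noteq> {}" and "pairwise disjnt \<U>"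
  shows "components (\<Union>\<U>) = \<U>"
proof -
  have comp: "U \<in> components (\<Union>\<U>)" if U: "U \<in> \<U>" for U
    unfolding in_components_maximal
  proof (intro conjI allI impI)
    fix D assume D: "D \<noteq> {} \<and> U \<subseteq> D \<and> D \<subseteq> \<Union>\<U> \<and> connected D"
    have "open U" "open (\<Union>(\<U> - {U}))" using assms(1) U by auto
    moreover have "U \<inter> \<Union>(\<U> - {U}) = {}"
      using assms(2) U by (auto simp: pairwise_def disjnt_iff)
    moreover have "D \<subseteq> U \<union> \<Union>(\<U> - {U})" using D by auto
    moreover have "U \<inter> D \<noteq> {}" using D assms(1)[OF U] by auto
    ultimately have "\<Union>(\<U> - {U}) \<inter> D = {}"
      using D connectedD[of D U "\<Union>(\<U> - {U})"] by blast
    then show "D = U" using D by blast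
  qed (use assms(1) U in auto)
  moreover have "c \<in> \<U>" if c: "c \<in> components (\<Union>\<U>)" for c
  proof -
    obtain x where "x \<in> c" using in_components_nonempty[OF c] by auto
    moreover obtain U where "U \<in> \<U>" "x \<in> U"
      using in_components_subset[OF c] \<open>x \<in> c\<close> by auto
    ultimately show ?thesis
      using components_nonoverlap[OF c comp[of U]] by blast
  qed
  ultimately show ?thesis by blast
qed

text \<open>Moving towards \<open>q\<close> commutes with convex combinations, so an approach
  through \<open>g\<close> that is tested only at \<open>a\<close> and \<open>b\<close> yields one
  for every point of the segment. Letting \<open>t\<close> tend to 0 puts that point into the
  closure of \<open>f\<close>. The convex piece \<open>g\<close> may be smaller than
  \<open>f\<close>, which covers the non-convex outer face.\<close>

lemma closed_segment_subset_frontier: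
  fixes a b q :: "'a::real_normed_vector"
  assumes "convex g" "g \<subseteq> f" "open f" "closed_segment a b \<inter> f = {}"
    and ab: "\<And>t::real. 0 < t \<Longrightarrow> t < 1 \<Longrightarrow> a + t *\<^sub>R (q - a) \<in> g \<and> b + t *\<^sub>R (q - b) \<in> g"
  shows "closed_segment a b \<subseteq> frontier f"
proof
  fix p assume p: "p \<in> closed_segment a b"
  then obtain s where s: "0 \<le> s" "s \<le> 1" "p = (1 - s) *\<^sub>R a + s *\<^sub>R b"
    by (auto simp: in_segment)
  have mem: "p + t *\<^sub>R (q - p) \<in> f" if "0 < t" "t < 1" for t :: real
  proof -
    have "(1 - s) *\<^sub>R (a + t *\<^sub>R (q - a)) + s *\<^sub>R (b + t *\<^sub>R (q - b)) \<in> g"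
      using ab[OF that] s assms(1) by (intro convexD) auto
    also have "(1 - s) *\<^sub>R (a + t *\<^sub>R (q - a)) + s *\<^sub>R (b + t *\<^sub>R (q - b)) = p + t *\<^sub>R (q - p)"
      by (simp add: s algebra_simps)
    finally show ?thesis using assms(2) by blast
  qed
  have "((\<lambda>t. p + t *\<^sub>R (q - p)) \<longlongrightarrow> p + 0 *\<^sub>R (q - p)) (at_right (0::real))"
    by (intro tendsto_intros)
  moreover have "eventually (\<lambda>t. p + t *\<^sub>R (q - p) \<in> closure f) (at_right (0::real))"
    unfolding eventually_at_right_field using mem closure_subset by (intro exI[of _ 1]) auto
  ultimately have "p \<in> closure f"
    using Lim_in_closed_set[OF closed_closure] by fastforce
  moreover have "p \<notin> interior f" using p assms(3,4) by (auto simp: interior_open)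
  ultimately show "p \<in> frontier f" by (simp add: frontier_def)
qed

lemma mem_segment_Complex:
  "z \<in> closed_segment (Complex a b) (Complex c d) \<longleftrightarrow>
     (\<exists>t. 0 \<le> t \<and> t \<le> 1 \<and> Re z = a + t * (c - a) \<and> Im z = b + t * (d - b))"
proof -
  have "z = (1 - t) *\<^sub>R Complex a b + t *\<^sub>R Complex c d \<longleftrightarrow>
      Re z = a + t * (c - a) \<and> Im z = b + t * (d - b)" for t
    by (simp add: complex_eq_iff left_diff_distrib right_diff_distrib) argo
  then show ?thesis unfolding in_segment by blast
qed

text \<open>In a simple graph an edge is determined by its ends, so the vertex map forces the edge
  map: apply \<open>\<phi>\<close> to the ends and look up the edge of \<open>H\<close> that has
  them.\<close>

lemma iso_mgraphI_simple:
  assumes "simple_mgraph G" "simple_mgraph H" "bij_betw \<phi> (verts G) (verts H)"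
    and eq: "(`) \<phi> ` ends G ` edges G = ends H ` edges H"
  shows "iso_mgraph G H"
proof -
  have G: "bij_betw (ends G) (edges G) (ends G ` edges G)"
    and H: "bij_betw (ends H) (edges H) (ends H ` edges H)"
    using assms(1,2) by (auto simp: simple_mgraph_def bij_betw_def)
  have sub: "ends G ` edges G \<subseteq> Pow (verts G)"
    using assms(1) by (auto simp: simple_mgraph_def)
  have "bij_betw ((`) \<phi>) (ends G ` edges G) (ends H ` edges H)"
    unfolding bij_betw_def eq[symmetric]
    using inj_on_subset[OF inj_on_image_Pow sub] assms(3) by (auto simp: bij_betw_def)
  then have *: "bij_betw (inv_into (edges H) (ends H) \<circ> ((`) \<phi> \<circ> ends G)) (edges G) (edges H)"
    using bij_betw_trans[OF bij_betw_trans[OF G] bij_betw_inv_into[OF H]] by blast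
  have "ends H ((inv_into (edges H) (ends H) \<circ> ((`) \<phi> \<circ> ends G)) e) = \<phi> ` ends G e"
    if "e \<in> edges G" for e
  proof -
    have "\<phi> ` ends G e \<in> ends H ` edges H" using eq that by blast
    then show ?thesis by (simp add: f_inv_into_f)
  qed
  with * assms(3) show ?thesis unfolding iso_mgraph_def by blast
qed

section \<open>Contraction sequences and two criteria for twin-width\<close>

lemma is_trigraph_contract:
  assumes "is_trigraph T" "u \<in> tverts T" "v \<in> tverts T" "u \<noteq> v"
  shows "is_trigraph (contract T u v u)"
proof -
  have T: "finite (tverts T)" "black T \<inter> red T = {}"
    "\<And>e. e \<in> black T \<union> red T \<Longrightarrow> e \<subseteq> tverts T \<and> card e = 2"
    using assms(1) by (auto simp: is_trigraph_def)
  have "black (contract T u v u) \<inter> red (contract T u v u) = {}"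
    using T(2) by (auto simp: contract_def Let_def tadj_def doubleton_eq_iff)
  moreover have "e \<subseteq> tverts (contract T u v u) \<and> card e = 2"
    if "e \<in> black (contract T u v u) \<union> red (contract T u v u)" for e
    using that T(3) by (auto simp: contract_def Let_def)
  moreover have "finite (tverts (contract T u v u))"
    using T(1) by (simp add: contract_def Let_def)
  ultimately show ?thesis by (simp add: is_trigraph_def)
qed

lemma card_tverts_contract:
  assumes "finite (tverts T)" "u \<in> tverts T" "v \<in> tverts T" "u \<noteq> v"
  shows "card (tverts T) = Suc (card (tverts (contract T u v u)))"
proof -
  have "tverts (contract T u v u) = tverts T - {v}"
    using assms by (auto simp: contract_def Let_def)
  then show ?thesis using card.remove[OF assms(1,3)] by simp
qed

text \<open>Without such a sequence the \<open>LEAST\<close> in the definition of \<open>tww\<close> would be a junk value.\<close>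

lemma d_sequence_exists:
  assumes "is_trigraph T"
  shows "\<exists>d S. d_sequence d T S"
  using assms
proof (induction "card (tverts T)" arbitrary: T)
  case 0
  then show ?case by (intro exI[of _ 0] exI[of _ "\<lambda>_. T"]) (simp add: d_sequence_def)
next
  case (Suc n)
  have fin: "finite (tverts T)" using Suc.prems by (simp add: is_trigraph_def)
  \<comment> \<open>A crude common bound for the red degrees of \<open>T\<close>; any finite
    \<open>d\<close> will do.\<close>
  define d0 where "d0 = (\<Sum>x\<in>tverts T. red_degree T x)"
  have d0: "red_degree T x \<le> d0" if "x \<in> tverts T" for x
    unfolding d0_def using that fin by (simp add: member_le_sum)
  show ?case
  proof (cases "n = 0")
    case True
    then show ?thesis using Suc d0
      by (intro exI[of _ d0] exI[of _ "\<lambda>_. T"]) (simp add: d_sequence_def Suc.hyps(2)[symmetric])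
  next
    case False
    obtain u where u: "u \<in> tverts T" using Suc.hyps(2) by fastforce
    have "card (tverts T - {u}) = n" using Suc.hyps(2) u fin by simp
    then obtain v where v: "v \<in> tverts T" "u \<noteq> v"
      using False by (metis DiffE card.empty ex_in_conv singletonI)
    let ?T = "contract T u v u"
    have cT: "card (tverts ?T) = n"
      using card_tverts_contract[OF fin u v] Suc.hyps(2) by simp
    obtain d S where S: "d_sequence d ?T S"
      using Suc.hyps(1)[of ?T] cT is_trigraph_contract[OF Suc.prems u v] by auto
    have "contracts_to T ?T" unfolding contracts_to_def using u v by blast
    \<comment> \<open>The sequence of the contracted trigraph occupies the indices up to
      \<open>n\<close>; \<open>T\<close> is placed at the next one, and the maximum bounds the red
      degrees of both.\<close>
    then have "d_sequence (max d d0) T (S(Suc n := T))"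
      using S cT Suc.prems d0 unfolding d_sequence_def Let_def Suc.hyps(2)[symmetric]
      by (auto simp: le_Suc_eq less_Suc_eq max.coboundedI1 max.coboundedI2)
    then show ?thesis by blast
  qed
qed

text \<open>The least \<open>d\<close> is attained, so a value 0 would come from an actual
  0-sequence. Its first contraction merges some \<open>u\<close> and \<open>v\<close>, and a vertex
  adjacent to exactly one of them is then joined to the new vertex by a red edge.\<close>

lemma tww_neq_0_if_no_twins:
  assumes "is_trigraph (trigraph_of G)" and "card (verts G) \<ge> 2"
    and twinfree: "\<forall>u\<in>verts G. \<forall>v\<in>verts G. u \<noteq> v \<longrightarrow>
      (\<exists>x\<in>verts G. x \<noteq> u \<and> x \<noteq> v \<and>
        ({u, x} \<in> ends G ` edges G) \<noteq> ({v, x} \<in> ends G ` edges G))"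
  shows "tww G \<noteq> 0"
proof
  let ?T = "trigraph_of G"
  assume "tww G = 0"
  then obtain S where S: "d_sequence 0 ?T S"
    using LeastI_ex[OF d_sequence_exists[OF assms(1)]] unfolding tww_def by auto
  \<comment> \<open>Indices count vertices, so \<open>S n\<close> is the trigraph right after the
    first contraction.\<close>
  define n where "n = card (verts G) - 1"
  have n: "card (tverts ?T) = Suc n" "n \<ge> 1"
    using assms(2) by (auto simp: n_def trigraph_of_def)
  have Sn: "S (Suc n) = ?T" "contracts_to (S (Suc n)) (S n)" "is_trigraph (S n)"
    "\<forall>x\<in>tverts (S n). red_degree (S n) x = 0"
    using S n unfolding d_sequence_def Let_def by (auto dest!: bspec[of _ _ n])
  from Sn(1,2) obtain u v w where uv: "u \<in> verts G" "v \<in> verts G" "u \<noteq> v"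
    and Sc: "S n = contract ?T u v w"
    unfolding contracts_to_def by (auto simp: trigraph_of_def)
  obtain x where x: "x \<in> verts G" "x \<noteq> u" "x \<noteq> v"
    "({u, x} \<in> ends G ` edges G) \<noteq> ({v, x} \<in> ends G ` edges G)"
    using bspec[OF bspec[OF twinfree uv(1)] uv(2)] uv(3) by (elim impE bexE) auto
  have "{w, x} \<in> red (S n)" using x by (auto simp: Sc contract_def Let_def tadj_def trigraph_of_def)
  moreover have "w \<in> tverts (S n)" by (simp add: Sc contract_def Let_def)
  \<comment> \<open>\<open>card\<close> is 0 on infinite sets, so red degree 0 excludes a red edge
    only together with finiteness.\<close>
  moreover have "finite {e \<in> red (S n). w \<in> e}"
    using Sn(3) by (auto simp: is_trigraph_def intro: finite_subset[of _ "Pow (tverts (S n))"])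
  ultimately show False using Sn(4) by (fastforce simp: red_degree_def)
qed

text \<open>Contracting twins in the absence of red edges amounts to deleting one of them.\<close>

lemma tww_eq_0_if_twin_order:
  fixes G :: "('v, 'e) mgraph" and vs :: "'v list"
  assumes T: "is_trigraph (trigraph_of G)" and vs: "distinct vs" "set vs = verts G"
    and twins: "\<And>i j. j < i \<Longrightarrow> Suc i < length vs \<Longrightarrow>
      {vs ! i, vs ! j} \<in> ends G ` edges G \<longleftrightarrow> {vs ! Suc i, vs ! j} \<in> ends G ` edges G"
  shows "tww G = 0"
proof -
  let ?B = "ends G ` edges G"
  \<comment> \<open>The subgraph induced by the first \<open>i\<close> vertices of the list, all of
    its edges black.\<close>
  define S where "S = (\<lambda>i. \<lparr>tverts = set (take i vs), black = {e \<in> ?B. e \<subseteq> set (take i vs)},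
    red = {}\<rparr> :: 'v trigraph)"
  have cardv: "card (tverts (trigraph_of G)) = length vs"
    using vs distinct_card[of vs] by (simp add: trigraph_of_def)
  have B: "e \<subseteq> verts G \<and> card e = 2" if "e \<in> ?B" for e
    using that T by (auto simp: is_trigraph_def trigraph_of_def)
  have last: "S (length vs) = trigraph_of G"
    using B vs by (auto simp: S_def trigraph_of_def)
  have tri: "is_trigraph (S i)" for i
    using B by (auto simp: S_def is_trigraph_def)
  have step: "contracts_to (S (Suc i)) (S i)" if i: "1 \<le> i" "i < length vs" for i
  proof -
    obtain k where k: "i = Suc k" using i by (cases i) auto
    let ?X = "set (take k vs)" and ?u = "vs ! k" and ?v = "vs ! Suc k"
    have tk: "set (take (Suc k) vs) = insert ?u ?X"
      "set (take (Suc (Suc k)) vs) = insert ?v (insert ?u ?X)"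
      using i k by (auto simp: take_Suc_conv_app_nth)
    \<comment> \<open>The last two of the first \<open>k + 2\<close> vertices are merged. The name
      \<open>?u\<close> is reused for the new vertex, so the result is literally the next induced
      subgraph.\<close>
    have "distinct (take (Suc (Suc k)) vs)" using vs by simp
    then have d: "?u \<notin> ?X" "?v \<notin> ?X" "?u \<noteq> ?v"
      using i k by (auto simp: take_Suc_conv_app_nth)
    have tw: "{?u, x} \<in> ?B \<longleftrightarrow> {?v, x} \<in> ?B" if "x \<in> ?X" for x
    proof -
      obtain j where "j < k" "x = vs ! j" using \<open>x \<in> ?X\<close> by (auto simp: in_set_conv_nth)
      then show ?thesis using twins[of j k] i k by simp
    qed
    have X: "tverts (S (Suc (Suc k))) - {?u, ?v} = ?X"
      using d by (auto simp: S_def tk)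
    have "black (contract (S (Suc (Suc k))) ?u ?v ?u) = black (S (Suc k))"
    proof (intro equalityI subsetI)
      fix e assume "e \<in> black (contract (S (Suc (Suc k))) ?u ?v ?u)"
      then show "e \<in> black (S (Suc k))"
        unfolding contract_def Let_def X by (auto simp: S_def tk)
    next
      fix e assume e: "e \<in> black (S (Suc k))"
      show "e \<in> black (contract (S (Suc (Suc k))) ?u ?v ?u)"
      \<comment> \<open>Edges at \<open>?u\<close> are rebuilt by the contraction and need the twin
        property; all others are copied.\<close>
      proof (cases "?u \<in> e")
        case True
        have "card e = 2" using e B by (auto simp: S_def)
        then obtain x where x: "e = {?u, x}" "x \<noteq> ?u" using True
          by (metis card_2_iff doubleton_eq_iff insertE singletonD)
        then have "x \<in> ?X" using e by (auto simp: S_def tk)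
        then show ?thesis using e x tw[of x] unfolding contract_def Let_def X
          by (auto simp: S_def tk)
      next
        case False
        then show ?thesis using e d unfolding contract_def Let_def X by (auto simp: S_def tk)
      qed
    qed
    moreover have "red (contract (S (Suc (Suc k))) ?u ?v ?u) = {}"
      using tw unfolding contract_def Let_def X by (auto simp: S_def tadj_def tk)
    moreover have "tverts (contract (S (Suc (Suc k))) ?u ?v ?u) = tverts (S (Suc k))"
      unfolding contract_def Let_def X by (auto simp: S_def tk)
    ultimately have "S (Suc k) = contract (S (Suc (Suc k))) ?u ?v ?u"
      by (simp add: S_def)
    then show ?thesis unfolding contracts_to_def k using d
      by (intro exI[of _ ?u] exI[of _ ?v] exI[of _ ?u]) (auto simp: S_def tk)
  qed
  have "d_sequence 0 (trigraph_of G) S"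
    using last tri step unfolding d_sequence_def Let_def cardv
    by (auto simp: red_degree_def S_def)
  then show ?thesis unfolding tww_def by (intro Least_equality) auto
qed

lemma is_trigraph_trigraph_of: "simple_mgraph G \<Longrightarrow> is_trigraph (trigraph_of G)"
  by (auto simp: simple_mgraph_def is_trigraph_def trigraph_of_def)

section \<open>Connectedness and straight-line drawings\<close>

text \<open>Walks of length at most two from a root suffice for both the bipyramid and the prism,
  and any two vertices are then linked through the root.\<close>

lemma connected_mgraphI:
  assumes "r \<in> verts G" and "\<And>v. v \<in> verts G \<Longrightarrow>
    v = r \<or> {r, v} \<in> ends G ` edges G \<or>
    (\<exists>x. {r, x} \<in> ends G ` edges G \<and> {x, v} \<in> ends G ` edges G)"
  shows "connected_mgraph G"
proof -
  define R where "R = {(x, y). \<exists>e\<in>edges G. ends G e = {x, y}}"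
  have R: "(x, y) \<in> R \<longleftrightarrow> {x, y} \<in> ends G ` edges G" for x y
    by (auto simp: R_def image_iff)
  have rv: "(r, v) \<in> R\<^sup>*" if "v \<in> verts G" for v
    using assms(2)[OF that] unfolding R[symmetric] by (auto intro: rtrancl_trans)
  have "sym (R\<^sup>*)" by (rule sym_rtrancl) (auto simp: sym_def R insert_commute)
  then have "(u, v) \<in> R\<^sup>*" if "u \<in> verts G" "v \<in> verts G" for u v
    using symD[OF _ rv[OF that(1)]] rv[OF that(2)] by (auto intro: rtrancl_trans)
  then show ?thesis using assms(1) unfolding connected_mgraph_def R_def by blast
qed

text \<open>Eliminating the parameter \<open>t\<close> without division leaves conditions that are
  linear in \<open>Re z\<close> and \<open>Im z\<close> once the coordinates are numerals, so linear
  arithmetic can settle incidences.\<close>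

lemma mem_segment_Complex_slanted:
  assumes "a < c"
  shows "z \<in> closed_segment (Complex a b) (Complex c d) \<longleftrightarrow>
    a \<le> Re z \<and> Re z \<le> c \<and> (Im z - b) * (c - a) = (d - b) * (Re z - a)"
  unfolding mem_segment_Complex
proof (intro iffI)
  assume "\<exists>t. 0 \<le> t \<and> t \<le> 1 \<and> Re z = a + t * (c - a) \<and> Im z = b + t * (d - b)"
  then obtain t where t: "0 \<le> t" "t \<le> 1" "Re z = a + t * (c - a)" "Im z = b + t * (d - b)"
    by blast
  have "0 \<le> t * (c - a)" "t * (c - a) \<le> 1 * (c - a)"
    using t assms by (intro mult_nonneg_nonneg mult_right_mono; simp)+
  then show "a \<le> Re z \<and> Re z \<le> c \<and> (Im z - b) * (c - a) = (d - b) * (Re z - a)"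
    using t by simp
next
  assume *: "a \<le> Re z \<and> Re z \<le> c \<and> (Im z - b) * (c - a) = (d - b) * (Re z - a)"
  then show "\<exists>t. 0 \<le> t \<and> t \<le> 1 \<and> Re z = a + t * (c - a) \<and> Im z = b + t * (d - b)"
    \<comment> \<open>The parameter is recovered from the real part, which strictly increases along
      the segment.\<close>
    using assms by (intro exI[of _ "(Re z - a) / (c - a)"]) (auto simp: divide_simps algebra_simps)
qed

lemma mem_segment_Complex_vertical:
  assumes "b < d"
  shows "z \<in> closed_segment (Complex a b) (Complex a d) \<longleftrightarrow> Re z = a \<and> b \<le> Im z \<and> Im z \<le> d"
  unfolding mem_segment_Complex
proof (intro iffI)
  assume "\<exists>t. 0 \<le> t \<and> t \<le> 1 \<and> Re z = a + t * (a - a) \<and> Im z = b + t * (d - b)"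
  then obtain t where t: "0 \<le> t" "t \<le> 1" "Re z = a" "Im z = b + t * (d - b)"
    by auto
  have "0 \<le> t * (d - b)" "t * (d - b) \<le> 1 * (d - b)"
    using t assms by (intro mult_nonneg_nonneg mult_right_mono; simp)+
  then show "Re z = a \<and> b \<le> Im z \<and> Im z \<le> d" using t by simp
next
  assume "Re z = a \<and> b \<le> Im z \<and> Im z \<le> d"
  then show "\<exists>t. 0 \<le> t \<and> t \<le> 1 \<and> Re z = a + t * (a - a) \<and> Im z = b + t * (d - b)"
    using assms by (intro exI[of _ "(Im z - b) / (d - b)"]) (auto simp: divide_simps)
qed

lemmas mem_segment_coords = mem_segment_Complex_slanted mem_segment_Complex_vertical

lemma plane_graph_segments:
  assumes "finite V" "finite P"
    and "\<And>a b. (a, b) \<in> P \<Longrightarrow> a \<noteq> b \<and> closed_segment a b \<inter> V = {a, b}"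
    and "pairwise (\<lambda>(a, b) (c, d). closed_segment a b \<inter> closed_segment c d \<subseteq> V) P"
  shows "plane_graph V ((\<lambda>(a, b). closed_segment a b) ` P)"
  unfolding plane_graph_def
proof (intro conjI ballI impI)
  fix e assume "e \<in> (\<lambda>(a, b). closed_segment a b) ` P"
  then obtain a b where "(a, b) \<in> P" "e = closed_segment a b" by auto
  then show "\<exists>g. simple_path g \<and> path_image g = e \<and> e \<inter> V = {pathstart g, pathfinish g}"
    using assms(3) by (intro exI[of _ "linepath a b"]) (simp add: simple_path_linepath)
next
  fix e e' assume "e \<in> (\<lambda>(a, b). closed_segment a b) ` P"
    "e' \<in> (\<lambda>(a, b). closed_segment a b) ` P" "e \<noteq> e'"
  then obtain p q where "p \<in> P" "e = (\<lambda>(a, b). closed_segment a b) p"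
    "q \<in> P" "e' = (\<lambda>(a, b). closed_segment a b) q" "p \<noteq> q" by auto
  then show "e \<inter> e' \<subseteq> V" using pairwiseD[OF assms(4), of p q] by (auto split: prod.splits)
qed (use assms in auto)

text \<open>A straight edge is recovered from its two ends up to orientation, and reversing a
  segment gives the same set; so parallel edges cannot occur.\<close>

lemma simple_plane_mgraph_segments:
  assumes "plane_graph V ((\<lambda>(a, b). closed_segment a b) ` P)"
    and "\<And>a b. (a, b) \<in> P \<Longrightarrow> a \<noteq> b \<and> closed_segment a b \<inter> V = {a, b}"
  shows "simple_mgraph (plane_mgraph V ((\<lambda>(a, b). closed_segment a b) ` P))"
    and "ends (plane_mgraph V ((\<lambda>(a, b). closed_segment a b) ` P)) `
      (\<lambda>(a, b). closed_segment a b) ` P = (\<lambda>(a, b). {a, b}) ` P"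
proof -
  show "simple_mgraph (plane_mgraph V ((\<lambda>(a, b). closed_segment a b) ` P))"
    unfolding simple_mgraph_def
  proof (intro conjI ballI)
    show "inj_on (ends (plane_mgraph V ((\<lambda>(a, b). closed_segment a b) ` P)))
      (edges (plane_mgraph V ((\<lambda>(a, b). closed_segment a b) ` P)))"
      using assms(2) by (auto simp: plane_mgraph_def inj_on_def doubleton_eq_iff
        closed_segment_commute)
  qed (use assms in \<open>auto simp: plane_mgraph_def plane_graph_def\<close>)
  show "ends (plane_mgraph V ((\<lambda>(a, b). closed_segment a b) ` P)) `
      (\<lambda>(a, b). closed_segment a b) ` P = (\<lambda>(a, b). {a, b}) ` P"
    unfolding image_image using assms(2) by (intro image_cong) (auto simp: plane_mgraph_def)
qed

section \<open>Drawings of the bipyramid and of the prism\<close>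

text \<open>The apexes of the bipyramid are \<open>Complex 0 1\<close> and \<open>Complex 0 4\<close>. All edges lie on the
  lines \<open>y = 0\<close>, \<open>x = 0\<close> and \<open>y = c * (1 - \<bar>x\<bar>)\<close> for \<open>c = 1, 2, 4\<close>.\<close>

definition bipyramid_verts :: "complex set" where
  "bipyramid_verts = {Complex (-1) 0, Complex 1 0, Complex 0 2, Complex 0 1, Complex 0 4}"

text \<open>The equator is the triangle on \<open>Complex (-1) 0\<close>, \<open>Complex 1 0\<close>
  and \<open>Complex 0 2\<close>, with one apex inside and the other above it; the pair of apexes is
  the only one missing. Pairs run from left to right, vertical ones upwards, which matches the
  hypotheses of \<open>mem_segment_coords\<close>.\<close>

definition bipyramid_pairs :: "(complex \<times> complex) set" where
  "bipyramid_pairs =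
    {(Complex (-1) 0, Complex 1 0), (Complex (-1) 0, Complex 0 2), (Complex (-1) 0, Complex 0 1),
     (Complex (-1) 0, Complex 0 4), (Complex 0 2, Complex 1 0), (Complex 0 1, Complex 1 0),
     (Complex 0 4, Complex 1 0), (Complex 0 1, Complex 0 2), (Complex 0 2, Complex 0 4)}"

definition bipyramid_edges :: "complex set set" where
  "bipyramid_edges = (\<lambda>(a, b). closed_segment a b) ` bipyramid_pairs"

text \<open>Two nested triangles. Planarity of the dual asks only for some isomorphic plane graph,
  so this drawing is independent of the position of the faces of the bipyramid.\<close>

definition prism_verts :: "complex set" where
  "prism_verts = {Complex 0 4, Complex (-2) 0, Complex 2 0,
     Complex 0 2, Complex (-1) 1, Complex 1 1}"

definition prism_pairs :: "(complex \<times> complex) set" where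
  "prism_pairs =
    {(Complex (-2) 0, Complex 2 0), (Complex (-2) 0, Complex 0 4), (Complex 0 4, Complex 2 0),
     (Complex (-1) 1, Complex 1 1), (Complex (-1) 1, Complex 0 2), (Complex 0 2, Complex 1 1),
     (Complex (-2) 0, Complex (-1) 1), (Complex 1 1, Complex 2 0), (Complex 0 2, Complex 0 4)}"

definition prism_edges :: "complex set set" where
  "prism_edges = (\<lambda>(a, b). closed_segment a b) ` prism_pairs"

lemma bipyramid_pairs_ends:
  "(a, b) \<in> bipyramid_pairs \<Longrightarrow> a \<noteq> b \<and> closed_segment a b \<inter> bipyramid_verts = {a, b}"
  unfolding bipyramid_pairs_def bipyramid_verts_def
  by (elim insertE emptyE) (simp_all add: mem_segment_coords insert_commute)

lemma prism_pairs_ends: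
  "(a, b) \<in> prism_pairs \<Longrightarrow> a \<noteq> b \<and> closed_segment a b \<inter> prism_verts = {a, b}"
  unfolding prism_pairs_def prism_verts_def
  by (elim insertE emptyE) (simp_all add: mem_segment_coords insert_commute)

lemma plane_graph_bipyramid: "plane_graph bipyramid_verts bipyramid_edges"
  unfolding bipyramid_edges_def
proof (rule plane_graph_segments)
  show "pairwise (\<lambda>(a, b) (c, d). closed_segment a b \<inter> closed_segment c d \<subseteq> bipyramid_verts)
      bipyramid_pairs"
    unfolding bipyramid_pairs_def bipyramid_verts_def pairwise_def ball_simps prod.case
    by (intro conjI impI subsetI) (simp_all add: mem_segment_coords complex_eq_iff, argo+)
  show "finite bipyramid_verts" "finite bipyramid_pairs"
    by (simp_all add: bipyramid_verts_def bipyramid_pairs_def)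
qed (rule bipyramid_pairs_ends)

lemma plane_graph_prism: "plane_graph prism_verts prism_edges"
  unfolding prism_edges_def
proof (rule plane_graph_segments)
  show "pairwise (\<lambda>(a, b) (c, d). closed_segment a b \<inter> closed_segment c d \<subseteq> prism_verts)
      prism_pairs"
    unfolding prism_pairs_def prism_verts_def pairwise_def ball_simps prod.case
    by (intro conjI impI subsetI) (simp_all add: mem_segment_coords complex_eq_iff, argo+)
  show "finite prism_verts" "finite prism_pairs"
    by (simp_all add: prism_verts_def prism_pairs_def)
qed (rule prism_pairs_ends)

lemma simple_mgraph_bipyramid: "simple_mgraph (plane_mgraph bipyramid_verts bipyramid_edges)"
  and ends_bipyramid: "ends (plane_mgraph bipyramid_verts bipyramid_edges) ` bipyramid_edges =
    (\<lambda>(a, b). {a, b}) ` bipyramid_pairs"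
  unfolding bipyramid_edges_def
  by (rule simple_plane_mgraph_segments[OF plane_graph_bipyramid[unfolded bipyramid_edges_def]
      bipyramid_pairs_ends]; assumption)+

lemma simple_mgraph_prism: "simple_mgraph (plane_mgraph prism_verts prism_edges)"
  and ends_prism: "ends (plane_mgraph prism_verts prism_edges) ` prism_edges =
    (\<lambda>(a, b). {a, b}) ` prism_pairs"
  unfolding prism_edges_def
  by (rule simple_plane_mgraph_segments[OF plane_graph_prism[unfolded prism_edges_def]
      prism_pairs_ends]; assumption)+

lemma connected_mgraph_bipyramid: "connected_mgraph (plane_mgraph bipyramid_verts bipyramid_edges)"
proof (rule connected_mgraphI[where r = "Complex (-1) 0"])
  have edges: "edges (plane_mgraph bipyramid_verts bipyramid_edges) = bipyramid_edges"
    by (simp add: plane_mgraph_def)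
  show "Complex (-1) 0 \<in> verts (plane_mgraph bipyramid_verts bipyramid_edges)"
    by (simp add: plane_mgraph_def bipyramid_verts_def)
  fix v assume "v \<in> verts (plane_mgraph bipyramid_verts bipyramid_edges)"
  then have "v \<in> bipyramid_verts" by (simp add: plane_mgraph_def)
  \<comment> \<open>This equatorial vertex is adjacent to all others.\<close>
  then have "v = Complex (-1) 0 \<or> {Complex (-1) 0, v} \<in> (\<lambda>(a, b). {a, b}) ` bipyramid_pairs"
    unfolding bipyramid_verts_def bipyramid_pairs_def
    by (elim insertE emptyE) (simp_all add: doubleton_eq_iff)
  then show "v = Complex (-1) 0 \<or>
    {Complex (-1) 0, v} \<in> ends (plane_mgraph bipyramid_verts bipyramid_edges) `
      edges (plane_mgraph bipyramid_verts bipyramid_edges) \<or>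
    (\<exists>x. {Complex (-1) 0, x} \<in> ends (plane_mgraph bipyramid_verts bipyramid_edges) `
        edges (plane_mgraph bipyramid_verts bipyramid_edges) \<and>
      {x, v} \<in> ends (plane_mgraph bipyramid_verts bipyramid_edges) `
        edges (plane_mgraph bipyramid_verts bipyramid_edges))"
    unfolding edges ends_bipyramid by blast
qed

lemma tww_bipyramid: "tww (plane_mgraph bipyramid_verts bipyramid_edges) = 0"
proof (rule tww_eq_0_if_twin_order)
  \<comment> \<open>The apexes stand last because contractions consume the list from its
    end.\<close>
  let ?vs = "[Complex (-1) 0, Complex 1 0, Complex 0 2, Complex 0 1, Complex 0 4]"
  have edges: "edges (plane_mgraph bipyramid_verts bipyramid_edges) = bipyramid_edges"
    by (simp add: plane_mgraph_def)
  show "is_trigraph (trigraph_of (plane_mgraph bipyramid_verts bipyramid_edges))"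
    by (rule is_trigraph_trigraph_of[OF simple_mgraph_bipyramid])
  show "distinct ?vs" by simp
  show "set ?vs = verts (plane_mgraph bipyramid_verts bipyramid_edges)"
    by (simp add: plane_mgraph_def bipyramid_verts_def)
  fix i j assume "j < i" "Suc i < length ?vs"
  \<comment> \<open>For \<open>i = 3\<close> the two apexes are compared; for smaller
    \<open>i\<close> both vertices belong to the K_4 formed by the first four entries.\<close>
  then consider "i = 1" "j = 0" | "i = 2" "j = 0" | "i = 2" "j = 1" | "i = 3" "j = 0"
    | "i = 3" "j = 1" | "i = 3" "j = 2" by (simp, linarith)
  then show "{?vs ! i, ?vs ! j} \<in> ends (plane_mgraph bipyramid_verts bipyramid_edges) `
      edges (plane_mgraph bipyramid_verts bipyramid_edges) \<longleftrightarrow>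
    {?vs ! Suc i, ?vs ! j} \<in> ends (plane_mgraph bipyramid_verts bipyramid_edges) `
      edges (plane_mgraph bipyramid_verts bipyramid_edges)"
    unfolding edges ends_bipyramid bipyramid_pairs_def
    by cases (simp_all add: doubleton_eq_iff)
qed

section \<open>The faces of the bipyramid drawing\<close>

definition halfplane :: "real \<Rightarrow> real \<Rightarrow> real \<Rightarrow> complex set" where
  "halfplane a b c = {z. a * Re z + b * Im z < c}"

lemma open_halfplane: "open (halfplane a b c)"
  unfolding halfplane_def by (intro open_Collect_less continuous_intros)

lemma convex_halfplane: "convex (halfplane a b c)"
  using convex_halfspace_lt[of "Complex a b" c] by (simp add: halfplane_def inner_complex_def)

lemma mem_closure_halfplane:
  assumes "z \<in> closure (halfplane a b c)"
  shows "a * Re z + b * Im z \<le> c"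
proof -
  have "closure (halfplane a b c) \<subseteq> {z. a * Re z + b * Im z \<le> c}"
    unfolding halfplane_def
    by (intro closure_minimal closed_Collect_le continuous_intros) auto
  then show ?thesis using assms by blast
qed

text \<open>The closure of an intersection lies in each closed half-plane. One violated inequality
  thus certifies that a point is off the frontier of a face.\<close>

lemma frontier_halfplanes_Int:
  assumes "z \<in> frontier (halfplane a b c \<inter> halfplane a' b' c' \<inter> halfplane a'' b'' c'')"
  shows "a * Re z + b * Im z \<le> c \<and> a' * Re z + b' * Im z \<le> c' \<and> a'' * Re z + b'' * Im z \<le> c''"
proof -
  have "z \<in> closure (halfplane a b c \<inter> halfplane a' b' c' \<inter> halfplane a'' b'' c'')"
    using assms by (simp add: frontier_def)
  then have "z \<in> closure (halfplane a b c)" "z \<in> closure (halfplane a' b' c')"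
    "z \<in> closure (halfplane a'' b'' c'')"
    by (rule rev_subsetD, intro closure_mono, blast)+
  then show ?thesis by (simp add: mem_closure_halfplane)
qed

lemma frontier_halfplanes_Un:
  assumes "z \<in> frontier (halfplane a b c \<union> halfplane a' b' c' \<union> halfplane a'' b'' c'')"
  shows "a * Re z + b * Im z \<le> c \<or> a' * Re z + b' * Im z \<le> c' \<or> a'' * Re z + b'' * Im z \<le> c''"
proof -
  have "z \<in> closure (halfplane a b c) \<union> closure (halfplane a' b' c') \<union>
      closure (halfplane a'' b'' c'')"
    using assms by (simp add: frontier_def)
  then show ?thesis by (auto dest: mem_closure_halfplane)
qed

text \<open>The complement of the closed triangle with corners \<open>Complex (-1) 0\<close>,
  \<open>Complex 1 0\<close> and \<open>Complex 0 4\<close>.\<close>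

definition outer_face :: "complex set" where
  "outer_face =
     halfplane 0 1 0 \<union> halfplane (-4) (-1) (-4) \<union> halfplane 4 (-1) (-4)"

definition bottom_face :: "complex set" where
  "bottom_face =
     halfplane 0 (-1) 0 \<inter> halfplane 1 1 1 \<inter> halfplane (-1) 1 1"

text \<open>Lower and upper refer to the two sides of the equatorial edges on the line
  \<open>y = 2 * (1 - \<bar>x\<bar>)\<close>.\<close>

definition lower_left_face :: "complex set" where
  "lower_left_face =
     halfplane 1 0 0 \<inter> halfplane 1 (-1) (-1) \<inter> halfplane (-2) 1 2"

definition upper_left_face :: "complex set" where
  "upper_left_face =
     halfplane 1 0 0 \<inter> halfplane 2 (-1) (-2) \<inter> halfplane (-4) 1 4"

definition lower_right_face :: "complex set" where
  "lower_right_face =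
     halfplane (-1) 0 0 \<inter> halfplane (-1) (-1) (-1) \<inter> halfplane 2 1 2"

definition upper_right_face :: "complex set" where
  "upper_right_face =
     halfplane (-1) 0 0 \<inter> halfplane (-2) (-1) (-2) \<inter> halfplane 4 1 4"

lemmas bipyramid_face_defs = outer_face_def bottom_face_def lower_left_face_def
  upper_left_face_def lower_right_face_def upper_right_face_def

definition bipyramid_faces :: "complex set set" where
  "bipyramid_faces = {outer_face, bottom_face, lower_left_face, upper_left_face,
     lower_right_face, upper_right_face}"

text \<open>One sample point per face that avoids the other five; it shows both that the faces are
  nonempty and that they are distinct.\<close>

lemma face_points:
  shows "Complex 0 (-1) \<in> outer_face \<and> Complex 0 (-1) \<notin> bottom_face \<and>
      Complex 0 (-1) \<notin> lower_left_face \<and> Complex 0 (-1) \<notin> upper_left_face \<and>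
      Complex 0 (-1) \<notin> lower_right_face \<and> Complex 0 (-1) \<notin> upper_right_face"
    and "Complex 0 (1/2) \<notin> outer_face \<and> Complex 0 (1/2) \<in> bottom_face \<and>
      Complex 0 (1/2) \<notin> lower_left_face \<and> Complex 0 (1/2) \<notin> upper_left_face \<and>
      Complex 0 (1/2) \<notin> lower_right_face \<and> Complex 0 (1/2) \<notin> upper_right_face"
    and "Complex (-1/2) (3/4) \<notin> outer_face \<and> Complex (-1/2) (3/4) \<notin> bottom_face \<and>
      Complex (-1/2) (3/4) \<in> lower_left_face \<and> Complex (-1/2) (3/4) \<notin> upper_left_face \<and>
      Complex (-1/2) (3/4) \<notin> lower_right_face \<and> Complex (-1/2) (3/4) \<notin> upper_right_face"
    and "Complex (-1/2) (3/2) \<notin> outer_face \<and> Complex (-1/2) (3/2) \<notin> bottom_face \<and>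
      Complex (-1/2) (3/2) \<notin> lower_left_face \<and> Complex (-1/2) (3/2) \<in> upper_left_face \<and>
      Complex (-1/2) (3/2) \<notin> lower_right_face \<and> Complex (-1/2) (3/2) \<notin> upper_right_face"
    and "Complex (1/2) (3/4) \<notin> outer_face \<and> Complex (1/2) (3/4) \<notin> bottom_face \<and>
      Complex (1/2) (3/4) \<notin> lower_left_face \<and> Complex (1/2) (3/4) \<notin> upper_left_face \<and>
      Complex (1/2) (3/4) \<in> lower_right_face \<and> Complex (1/2) (3/4) \<notin> upper_right_face"
    and "Complex (1/2) (3/2) \<notin> outer_face \<and> Complex (1/2) (3/2) \<notin> bottom_face \<and>
      Complex (1/2) (3/2) \<notin> lower_left_face \<and> Complex (1/2) (3/2) \<notin> upper_left_face \<and>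
      Complex (1/2) (3/2) \<notin> lower_right_face \<and> Complex (1/2) (3/2) \<in> upper_right_face"
  by (simp_all add: bipyramid_face_defs halfplane_def)

lemma open_bipyramid_face: "f \<in> bipyramid_faces \<Longrightarrow> open f"
  unfolding bipyramid_faces_def
  by (auto simp: bipyramid_face_defs intro!: open_halfplane)

lemma convex_inner_face: "f \<in> bipyramid_faces \<Longrightarrow> f \<noteq> outer_face \<Longrightarrow> convex f"
  unfolding bipyramid_faces_def
  by (elim insertE emptyE)
    (simp_all add: bottom_face_def lower_left_face_def upper_left_face_def lower_right_face_def
      upper_right_face_def convex_Int convex_halfplane)

lemma connected_outer_face: "connected outer_face"
proof -
  \<comment> \<open>Both slanted half-planes meet the lower one, at a point below and beyond the
    corresponding corner of the outer triangle.\<close>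
  have "Complex (-2) (-1) \<in> halfplane 0 1 0 \<inter> halfplane 4 (-1) (-4)"
    "Complex 2 (-1) \<in> (halfplane 0 1 0 \<union> halfplane 4 (-1) (-4)) \<inter> halfplane (-4) (-1) (-4)"
    by (simp_all add: halfplane_def)
  then have "connected (halfplane 0 1 0 \<union> halfplane 4 (-1) (-4) \<union> halfplane (-4) (-1) (-4))"
    by (intro connected_Un convex_connected convex_halfplane) blast+
  then show ?thesis by (simp add: outer_face_def Un_ac)
qed

lemma faces_bipyramid: "faces bipyramid_verts bipyramid_edges = bipyramid_faces"
proof -
  have "components (\<Union>bipyramid_faces) = bipyramid_faces"
  proof (rule components_Union_open_disjoint)
    show "pairwise disjnt bipyramid_faces"
      unfolding bipyramid_faces_def pairwise_def ball_simps disjnt_iff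
      by (intro conjI impI allI)
        (simp_all add: bipyramid_face_defs halfplane_def, argo+)
    fix f assume f: "f \<in> bipyramid_faces"
    then have "f \<noteq> {}" using face_points unfolding bipyramid_faces_def by blast
    moreover have "connected f"
      using f connected_outer_face convex_inner_face convex_connected by blast
    ultimately show "open f \<and> connected f \<and> f \<noteq> {}" using open_bipyramid_face[OF f] by blast
  qed
  \<comment> \<open>Read pointwise, the partition of the plane into drawing and faces is a statement
    of linear arithmetic.\<close>
  moreover have "z \<in> - (bipyramid_verts \<union> \<Union>bipyramid_edges) \<longleftrightarrow> z \<in> \<Union>bipyramid_faces" for z
    unfolding bipyramid_verts_def bipyramid_edges_def bipyramid_pairs_def bipyramid_faces_def
      bipyramid_face_defs
    by (simp add: mem_segment_coords complex_eq_iff halfplane_def) argo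
  ultimately show ?thesis unfolding faces_def by (metis (no_types) subsetI subset_antisym)
qed

section \<open>Frontiers of the faces and edges of the dual\<close>

text \<open>As for the other inner faces, \<open>q\<close> is the sample point of the face: from
  each corner of the triangle the way towards it runs inside the open face.\<close>

lemma bottom_face_frontier:
  shows "closed_segment (Complex (-1) 0) (Complex 1 0) \<subseteq> frontier bottom_face"
    and "closed_segment (Complex (-1) 0) (Complex 0 1) \<subseteq> frontier bottom_face"
    and "closed_segment (Complex 0 1) (Complex 1 0) \<subseteq> frontier bottom_face"
proof -
  have f: "convex bottom_face" "open bottom_face"
    by (simp_all add: bottom_face_def convex_Int convex_halfplane open_Int open_halfplane)
  note * = closed_segment_subset_frontier[OF f(1) order.refl f(2), where q = "Complex 0 (1/2)"]
  show "closed_segment (Complex (-1) 0) (Complex 1 0) \<subseteq> frontier bottom_face"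
    by (rule *) (auto simp: bottom_face_def halfplane_def mem_segment_coords)
  show "closed_segment (Complex (-1) 0) (Complex 0 1) \<subseteq> frontier bottom_face"
    by (rule *) (auto simp: bottom_face_def halfplane_def mem_segment_coords)
  show "closed_segment (Complex 0 1) (Complex 1 0) \<subseteq> frontier bottom_face"
    by (rule *) (auto simp: bottom_face_def halfplane_def mem_segment_coords)
qed

lemma lower_left_face_frontier:
  shows "closed_segment (Complex (-1) 0) (Complex 0 2) \<subseteq> frontier lower_left_face"
    and "closed_segment (Complex (-1) 0) (Complex 0 1) \<subseteq> frontier lower_left_face"
    and "closed_segment (Complex 0 1) (Complex 0 2) \<subseteq> frontier lower_left_face"
proof -
  have f: "convex lower_left_face" "open lower_left_face"
    by (simp_all add: lower_left_face_def convex_Int convex_halfplane open_Int open_halfplane)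
  note * = closed_segment_subset_frontier[OF f(1) order.refl f(2), where q = "Complex (-1/2) (3/4)"]
  show "closed_segment (Complex (-1) 0) (Complex 0 2) \<subseteq> frontier lower_left_face"
    by (rule *) (auto simp: lower_left_face_def halfplane_def mem_segment_coords)
  show "closed_segment (Complex (-1) 0) (Complex 0 1) \<subseteq> frontier lower_left_face"
    by (rule *) (auto simp: lower_left_face_def halfplane_def mem_segment_coords)
  show "closed_segment (Complex 0 1) (Complex 0 2) \<subseteq> frontier lower_left_face"
    by (rule *) (auto simp: lower_left_face_def halfplane_def mem_segment_coords)
qed

lemma upper_left_face_frontier:
  shows "closed_segment (Complex (-1) 0) (Complex 0 2) \<subseteq> frontier upper_left_face"
    and "closed_segment (Complex (-1) 0) (Complex 0 4) \<subseteq> frontier upper_left_face"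
    and "closed_segment (Complex 0 2) (Complex 0 4) \<subseteq> frontier upper_left_face"
proof -
  have f: "convex upper_left_face" "open upper_left_face"
    by (simp_all add: upper_left_face_def convex_Int convex_halfplane open_Int open_halfplane)
  note * = closed_segment_subset_frontier[OF f(1) order.refl f(2), where q = "Complex (-1/2) (3/2)"]
  show "closed_segment (Complex (-1) 0) (Complex 0 2) \<subseteq> frontier upper_left_face"
    by (rule *) (auto simp: upper_left_face_def halfplane_def mem_segment_coords)
  show "closed_segment (Complex (-1) 0) (Complex 0 4) \<subseteq> frontier upper_left_face"
    by (rule *) (auto simp: upper_left_face_def halfplane_def mem_segment_coords)
  show "closed_segment (Complex 0 2) (Complex 0 4) \<subseteq> frontier upper_left_face"
    by (rule *) (auto simp: upper_left_face_def halfplane_def mem_segment_coords)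
qed

lemma lower_right_face_frontier:
  shows "closed_segment (Complex 0 2) (Complex 1 0) \<subseteq> frontier lower_right_face"
    and "closed_segment (Complex 0 1) (Complex 1 0) \<subseteq> frontier lower_right_face"
    and "closed_segment (Complex 0 1) (Complex 0 2) \<subseteq> frontier lower_right_face"
proof -
  have f: "convex lower_right_face" "open lower_right_face"
    by (simp_all add: lower_right_face_def convex_Int convex_halfplane open_Int open_halfplane)
  note * = closed_segment_subset_frontier[OF f(1) order.refl f(2), where q = "Complex (1/2) (3/4)"]
  show "closed_segment (Complex 0 2) (Complex 1 0) \<subseteq> frontier lower_right_face"
    by (rule *) (auto simp: lower_right_face_def halfplane_def mem_segment_coords)
  show "closed_segment (Complex 0 1) (Complex 1 0) \<subseteq> frontier lower_right_face"
    by (rule *) (auto simp: lower_right_face_def halfplane_def mem_segment_coords)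
  show "closed_segment (Complex 0 1) (Complex 0 2) \<subseteq> frontier lower_right_face"
    by (rule *) (auto simp: lower_right_face_def halfplane_def mem_segment_coords)
qed

lemma upper_right_face_frontier:
  shows "closed_segment (Complex 0 2) (Complex 1 0) \<subseteq> frontier upper_right_face"
    and "closed_segment (Complex 0 4) (Complex 1 0) \<subseteq> frontier upper_right_face"
    and "closed_segment (Complex 0 2) (Complex 0 4) \<subseteq> frontier upper_right_face"
proof -
  have f: "convex upper_right_face" "open upper_right_face"
    by (simp_all add: upper_right_face_def convex_Int convex_halfplane open_Int open_halfplane)
  note * = closed_segment_subset_frontier[OF f(1) order.refl f(2), where q = "Complex (1/2) (3/2)"]
  show "closed_segment (Complex 0 2) (Complex 1 0) \<subseteq> frontier upper_right_face"
    by (rule *) (auto simp: upper_right_face_def halfplane_def mem_segment_coords)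
  show "closed_segment (Complex 0 4) (Complex 1 0) \<subseteq> frontier upper_right_face"
    by (rule *) (auto simp: upper_right_face_def halfplane_def mem_segment_coords)
  show "closed_segment (Complex 0 2) (Complex 0 4) \<subseteq> frontier upper_right_face"
    by (rule *) (auto simp: upper_right_face_def halfplane_def mem_segment_coords)
qed

text \<open>For each side, the convex piece is the open half-plane beyond the line through that
  side, and \<open>q\<close> is a point of it.\<close>

lemma outer_face_frontier:
  shows "closed_segment (Complex (-1) 0) (Complex 1 0) \<subseteq> frontier outer_face"
    and "closed_segment (Complex (-1) 0) (Complex 0 4) \<subseteq> frontier outer_face"
    and "closed_segment (Complex 0 4) (Complex 1 0) \<subseteq> frontier outer_face"
proof -
  have op: "open outer_face" by (simp add: open_bipyramid_face bipyramid_faces_def)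
  show "closed_segment (Complex (-1) 0) (Complex 1 0) \<subseteq> frontier outer_face"
    by (rule closed_segment_subset_frontier[OF convex_halfplane[of "0" "1" "0"] _ op,
      where q = "Complex 0 (-1)"])
      (auto simp: outer_face_def halfplane_def mem_segment_coords)
  show "closed_segment (Complex (-1) 0) (Complex 0 4) \<subseteq> frontier outer_face"
    by (rule closed_segment_subset_frontier[OF convex_halfplane[of "4" "-1" "-4"] _ op,
      where q = "Complex (-1) 4"])
      (auto simp: outer_face_def halfplane_def mem_segment_coords)
  show "closed_segment (Complex 0 4) (Complex 1 0) \<subseteq> frontier outer_face"
    by (rule closed_segment_subset_frontier[OF convex_halfplane[of "-4" "-1" "-4"] _ op,
      where q = "Complex 1 4"])
      (auto simp: outer_face_def halfplane_def mem_segment_coords)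
qed

text \<open>Trivial coefficients are kept so that each line is a literal instance of the half-plane
  lemmas.\<close>

lemma bipyramid_face_frontier_bounds:
  shows "z \<in> frontier outer_face \<Longrightarrow>
      0 * Re z + 1 * Im z \<le> 0 \<or> (-4) * Re z + (-1) * Im z \<le> (-4) \<or> 4 * Re z + (-1) * Im z \<le> (-4)"
    and "z \<in> frontier bottom_face \<Longrightarrow>
      0 * Re z + (-1) * Im z \<le> 0 \<and> 1 * Re z + 1 * Im z \<le> 1 \<and> (-1) * Re z + 1 * Im z \<le> 1"
    and "z \<in> frontier lower_left_face \<Longrightarrow>
      1 * Re z + 0 * Im z \<le> 0 \<and> 1 * Re z + (-1) * Im z \<le> (-1) \<and> (-2) * Re z + 1 * Im z \<le> 2"
    and "z \<in> frontier upper_left_face \<Longrightarrow>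
      1 * Re z + 0 * Im z \<le> 0 \<and> 2 * Re z + (-1) * Im z \<le> (-2) \<and> (-4) * Re z + 1 * Im z \<le> 4"
    and "z \<in> frontier lower_right_face \<Longrightarrow>
      (-1) * Re z + 0 * Im z \<le> 0 \<and> (-1) * Re z + (-1) * Im z \<le> (-1) \<and> 2 * Re z + 1 * Im z \<le> 2"
    and "z \<in> frontier upper_right_face \<Longrightarrow>
      (-1) * Re z + 0 * Im z \<le> 0 \<and> (-2) * Re z + (-1) * Im z \<le> (-2) \<and> 4 * Re z + 1 * Im z \<le> 4"
  unfolding bipyramid_face_defs
  by (rule frontier_halfplanes_Un frontier_halfplanes_Int, assumption)+

text \<open>Two faces are ends by the frontier lemmas. The other four are excluded by a single test
  point, the midpoint of the edge, since the whole edge would have to lie on their frontier.\<close>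

lemma ends_dual_bipyramid:
  shows "ends (dual_mgraph bipyramid_verts bipyramid_edges)
      (closed_segment (Complex (-1) 0) (Complex 1 0)) = {outer_face, bottom_face}"
    and "ends (dual_mgraph bipyramid_verts bipyramid_edges)
      (closed_segment (Complex (-1) 0) (Complex 0 2)) = {lower_left_face, upper_left_face}"
    and "ends (dual_mgraph bipyramid_verts bipyramid_edges)
      (closed_segment (Complex (-1) 0) (Complex 0 1)) = {bottom_face, lower_left_face}"
    and "ends (dual_mgraph bipyramid_verts bipyramid_edges)
      (closed_segment (Complex (-1) 0) (Complex 0 4)) = {outer_face, upper_left_face}"
    and "ends (dual_mgraph bipyramid_verts bipyramid_edges)
      (closed_segment (Complex 0 2) (Complex 1 0)) = {lower_right_face, upper_right_face}"
    and "ends (dual_mgraph bipyramid_verts bipyramid_edges)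
      (closed_segment (Complex 0 1) (Complex 1 0)) = {bottom_face, lower_right_face}"
    and "ends (dual_mgraph bipyramid_verts bipyramid_edges)
      (closed_segment (Complex 0 4) (Complex 1 0)) = {outer_face, upper_right_face}"
    and "ends (dual_mgraph bipyramid_verts bipyramid_edges)
      (closed_segment (Complex 0 1) (Complex 0 2)) = {lower_left_face, lower_right_face}"
    and "ends (dual_mgraph bipyramid_verts bipyramid_edges)
      (closed_segment (Complex 0 2) (Complex 0 4)) = {upper_left_face, upper_right_face}"
proof -
  note bounds = bipyramid_face_frontier_bounds
  have "Complex 0 0 \<in> closed_segment (Complex (-1) 0) (Complex 1 0)"
    by (simp add: mem_segment_coords)
  moreover have "Complex 0 0 \<notin> frontier lower_left_face"
      "Complex 0 0 \<notin> frontier upper_left_face"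
      "Complex 0 0 \<notin> frontier lower_right_face"
      "Complex 0 0 \<notin> frontier upper_right_face"
    using bounds[of "Complex 0 0"] by auto
  ultimately show "ends (dual_mgraph bipyramid_verts bipyramid_edges)
      (closed_segment (Complex (-1) 0) (Complex 1 0)) = {outer_face, bottom_face}"
    using outer_face_frontier bottom_face_frontier
    unfolding dual_mgraph_def faces_bipyramid bipyramid_faces_def by auto
  have "Complex (-1/2) 1 \<in> closed_segment (Complex (-1) 0) (Complex 0 2)"
    by (simp add: mem_segment_coords)
  moreover have "Complex (-1/2) 1 \<notin> frontier outer_face"
      "Complex (-1/2) 1 \<notin> frontier bottom_face"
      "Complex (-1/2) 1 \<notin> frontier lower_right_face"
      "Complex (-1/2) 1 \<notin> frontier upper_right_face"
    using bounds[of "Complex (-1/2) 1"] by auto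
  ultimately show "ends (dual_mgraph bipyramid_verts bipyramid_edges)
      (closed_segment (Complex (-1) 0) (Complex 0 2)) = {lower_left_face, upper_left_face}"
    using lower_left_face_frontier upper_left_face_frontier
    unfolding dual_mgraph_def faces_bipyramid bipyramid_faces_def by auto
  have "Complex (-1/2) (1/2) \<in> closed_segment (Complex (-1) 0) (Complex 0 1)"
    by (simp add: mem_segment_coords)
  moreover have "Complex (-1/2) (1/2) \<notin> frontier outer_face"
      "Complex (-1/2) (1/2) \<notin> frontier upper_left_face"
      "Complex (-1/2) (1/2) \<notin> frontier lower_right_face"
      "Complex (-1/2) (1/2) \<notin> frontier upper_right_face"
    using bounds[of "Complex (-1/2) (1/2)"] by auto
  ultimately show "ends (dual_mgraph bipyramid_verts bipyramid_edges)
      (closed_segment (Complex (-1) 0) (Complex 0 1)) = {bottom_face, lower_left_face}"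
    using bottom_face_frontier lower_left_face_frontier
    unfolding dual_mgraph_def faces_bipyramid bipyramid_faces_def by auto
  have "Complex (-1/2) 2 \<in> closed_segment (Complex (-1) 0) (Complex 0 4)"
    by (simp add: mem_segment_coords)
  moreover have "Complex (-1/2) 2 \<notin> frontier bottom_face"
      "Complex (-1/2) 2 \<notin> frontier lower_left_face"
      "Complex (-1/2) 2 \<notin> frontier lower_right_face"
      "Complex (-1/2) 2 \<notin> frontier upper_right_face"
    using bounds[of "Complex (-1/2) 2"] by auto
  ultimately show "ends (dual_mgraph bipyramid_verts bipyramid_edges)
      (closed_segment (Complex (-1) 0) (Complex 0 4)) = {outer_face, upper_left_face}"
    using outer_face_frontier upper_left_face_frontier
    unfolding dual_mgraph_def faces_bipyramid bipyramid_faces_def by auto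
  have "Complex (1/2) 1 \<in> closed_segment (Complex 0 2) (Complex 1 0)"
    by (simp add: mem_segment_coords)
  moreover have "Complex (1/2) 1 \<notin> frontier outer_face"
      "Complex (1/2) 1 \<notin> frontier bottom_face"
      "Complex (1/2) 1 \<notin> frontier lower_left_face"
      "Complex (1/2) 1 \<notin> frontier upper_left_face"
    using bounds[of "Complex (1/2) 1"] by auto
  ultimately show "ends (dual_mgraph bipyramid_verts bipyramid_edges)
      (closed_segment (Complex 0 2) (Complex 1 0)) = {lower_right_face, upper_right_face}"
    using lower_right_face_frontier upper_right_face_frontier
    unfolding dual_mgraph_def faces_bipyramid bipyramid_faces_def by auto
  have "Complex (1/2) (1/2) \<in> closed_segment (Complex 0 1) (Complex 1 0)"
    by (simp add: mem_segment_coords)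
  moreover have "Complex (1/2) (1/2) \<notin> frontier outer_face"
      "Complex (1/2) (1/2) \<notin> frontier lower_left_face"
      "Complex (1/2) (1/2) \<notin> frontier upper_left_face"
      "Complex (1/2) (1/2) \<notin> frontier upper_right_face"
    using bounds[of "Complex (1/2) (1/2)"] by auto
  ultimately show "ends (dual_mgraph bipyramid_verts bipyramid_edges)
      (closed_segment (Complex 0 1) (Complex 1 0)) = {bottom_face, lower_right_face}"
    using bottom_face_frontier lower_right_face_frontier
    unfolding dual_mgraph_def faces_bipyramid bipyramid_faces_def by auto
  have "Complex (1/2) 2 \<in> closed_segment (Complex 0 4) (Complex 1 0)"
    by (simp add: mem_segment_coords)
  moreover have "Complex (1/2) 2 \<notin> frontier bottom_face"
      "Complex (1/2) 2 \<notin> frontier lower_left_face"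
      "Complex (1/2) 2 \<notin> frontier upper_left_face"
      "Complex (1/2) 2 \<notin> frontier lower_right_face"
    using bounds[of "Complex (1/2) 2"] by auto
  ultimately show "ends (dual_mgraph bipyramid_verts bipyramid_edges)
      (closed_segment (Complex 0 4) (Complex 1 0)) = {outer_face, upper_right_face}"
    using outer_face_frontier upper_right_face_frontier
    unfolding dual_mgraph_def faces_bipyramid bipyramid_faces_def by auto
  have "Complex 0 (3/2) \<in> closed_segment (Complex 0 1) (Complex 0 2)"
    by (simp add: mem_segment_coords)
  moreover have "Complex 0 (3/2) \<notin> frontier outer_face"
      "Complex 0 (3/2) \<notin> frontier bottom_face"
      "Complex 0 (3/2) \<notin> frontier upper_left_face"
      "Complex 0 (3/2) \<notin> frontier upper_right_face"
    using bounds[of "Complex 0 (3/2)"] by auto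
  ultimately show "ends (dual_mgraph bipyramid_verts bipyramid_edges)
      (closed_segment (Complex 0 1) (Complex 0 2)) = {lower_left_face, lower_right_face}"
    using lower_left_face_frontier lower_right_face_frontier
    unfolding dual_mgraph_def faces_bipyramid bipyramid_faces_def by auto
  have "Complex 0 3 \<in> closed_segment (Complex 0 2) (Complex 0 4)"
    by (simp add: mem_segment_coords)
  moreover have "Complex 0 3 \<notin> frontier outer_face"
      "Complex 0 3 \<notin> frontier bottom_face"
      "Complex 0 3 \<notin> frontier lower_left_face"
      "Complex 0 3 \<notin> frontier lower_right_face"
    using bounds[of "Complex 0 3"] by auto
  ultimately show "ends (dual_mgraph bipyramid_verts bipyramid_edges)
      (closed_segment (Complex 0 2) (Complex 0 4)) = {upper_left_face, upper_right_face}"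
    using upper_left_face_frontier upper_right_face_frontier
    unfolding dual_mgraph_def faces_bipyramid bipyramid_faces_def by auto
qed

lemma ends_dual_bipyramid_image:
  "ends (dual_mgraph bipyramid_verts bipyramid_edges) ` bipyramid_edges =
    {{outer_face, bottom_face}, {lower_left_face, upper_left_face}, {bottom_face, lower_left_face},
     {outer_face, upper_left_face}, {lower_right_face, upper_right_face},
     {bottom_face, lower_right_face}, {outer_face, upper_right_face},
     {lower_left_face, lower_right_face}, {upper_left_face, upper_right_face}}"
proof -
  \<comment> \<open>Folding the dual into \<open>D\<close> protects its argument
    \<open>bipyramid_edges\<close> when the edge set is unfolded.\<close>
  define D where "D = dual_mgraph bipyramid_verts bipyramid_edges"
  show ?thesis
    unfolding D_def[symmetric]
    unfolding bipyramid_edges_def bipyramid_pairs_def image_insert image_empty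
      prod.case ends_dual_bipyramid[folded D_def] by (rule refl)
qed

section \<open>The dual as a planar prism without twins\<close>

lemma dual_bipyramid_simps:
  "verts (dual_mgraph bipyramid_verts bipyramid_edges) = bipyramid_faces"
  "edges (dual_mgraph bipyramid_verts bipyramid_edges) = bipyramid_edges"
  by (simp_all add: dual_mgraph_def faces_bipyramid)

lemma face_neqs:
  "outer_face \<noteq> bottom_face" "outer_face \<noteq> lower_left_face" "outer_face \<noteq> upper_left_face"
  "outer_face \<noteq> lower_right_face" "outer_face \<noteq> upper_right_face" "bottom_face \<noteq> lower_left_face"
  "bottom_face \<noteq> upper_left_face" "bottom_face \<noteq> lower_right_face"
  "bottom_face \<noteq> upper_right_face" "lower_left_face \<noteq> upper_left_face"
  "lower_left_face \<noteq> lower_right_face" "lower_left_face \<noteq> upper_right_face"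
  "upper_left_face \<noteq> lower_right_face" "upper_left_face \<noteq> upper_right_face"
  "lower_right_face \<noteq> upper_right_face"
  using face_points by metis+

lemma simple_mgraph_dual_bipyramid: "simple_mgraph (dual_mgraph bipyramid_verts bipyramid_edges)"
proof -
  define D where "D = dual_mgraph bipyramid_verts bipyramid_edges"
  note ends = ends_dual_bipyramid[folded D_def]
  have "\<forall>e\<in>bipyramid_edges. ends D e \<subseteq> bipyramid_faces \<and> card (ends D e) = 2"
    unfolding bipyramid_edges_def bipyramid_pairs_def image_insert image_empty prod.case ball_simps
      ends bipyramid_faces_def
    by (simp add: face_neqs)
  moreover have "inj_on (ends D) bipyramid_edges"
    unfolding inj_on_def bipyramid_edges_def bipyramid_pairs_def image_insert image_empty prod.case
      ball_simps ends
    by (simp add: doubleton_eq_iff face_neqs face_neqs[symmetric])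
  moreover have "finite bipyramid_faces" "finite bipyramid_edges"
    by (simp_all add: bipyramid_faces_def bipyramid_edges_def bipyramid_pairs_def)
  ultimately show ?thesis
    unfolding simple_mgraph_def D_def dual_bipyramid_simps by blast
qed

text \<open>The outer face is adjacent to the bottom face and to both upper ones; the lower faces
  are reached through the bottom face.\<close>

lemma connected_mgraph_dual_bipyramid:
  "connected_mgraph (dual_mgraph bipyramid_verts bipyramid_edges)"
proof (rule connected_mgraphI[where r = outer_face];
    unfold dual_bipyramid_simps ends_dual_bipyramid_image)
  show "outer_face \<in> bipyramid_faces" by (simp add: bipyramid_faces_def)
qed (unfold bipyramid_faces_def, elim insertE emptyE,
    simp_all add: doubleton_eq_iff face_neqs face_neqs[symmetric], blast+)

lemma planar_mgraph_dual_bipyramid: "planar_mgraph (dual_mgraph bipyramid_verts bipyramid_edges)"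
proof -
  \<comment> \<open>The three faces around the apex \<open>Complex 0 4\<close> go to the outer
    triangle, those around \<open>Complex 0 1\<close> to the inner one. The spokes are the duals of
    the equatorial edges.\<close>
  define \<phi> where "\<phi> f = (if f = outer_face then Complex 0 4
    else if f = upper_left_face then Complex (-2) 0
    else if f = upper_right_face then Complex 2 0
    else if f = bottom_face then Complex 0 2
    else if f = lower_left_face then Complex (-1) 1 else Complex 1 1)" for f
  have \<phi>: "\<phi> outer_face = Complex 0 4" "\<phi> upper_left_face = Complex (-2) 0"
    "\<phi> upper_right_face = Complex 2 0" "\<phi> bottom_face = Complex 0 2"
    "\<phi> lower_left_face = Complex (-1) 1" "\<phi> lower_right_face = Complex 1 1"
    by (simp_all add: \<phi>_def face_neqs face_neqs[symmetric])
  have "iso_mgraph (dual_mgraph bipyramid_verts bipyramid_edges)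
    (plane_mgraph prism_verts prism_edges)"
  proof (rule iso_mgraphI_simple[OF simple_mgraph_dual_bipyramid simple_mgraph_prism])
    have "inj_on \<phi> bipyramid_faces" unfolding inj_on_def bipyramid_faces_def ball_simps
      by (simp add: \<phi>)
    moreover have "\<phi> ` bipyramid_faces = prism_verts"
      unfolding bipyramid_faces_def prism_verts_def image_insert image_empty \<phi> by blast
    ultimately show "bij_betw \<phi> (verts (dual_mgraph bipyramid_verts bipyramid_edges))
        (verts (plane_mgraph prism_verts prism_edges))"
      by (simp add: bij_betw_def dual_bipyramid_simps plane_mgraph_def)
    have "edges (plane_mgraph prism_verts prism_edges) = prism_edges"
      by (simp add: plane_mgraph_def)
    then show "(`) \<phi> ` ends (dual_mgraph bipyramid_verts bipyramid_edges) `
        edges (dual_mgraph bipyramid_verts bipyramid_edges) =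
      ends (plane_mgraph prism_verts prism_edges) ` edges (plane_mgraph prism_verts prism_edges)"
      by (simp add: dual_bipyramid_simps ends_dual_bipyramid_image ends_prism prism_pairs_def \<phi>
          insert_commute)
  qed
  then show ?thesis unfolding planar_mgraph_def using plane_graph_prism by blast
qed

text \<open>Two vertices of one triangle of the prism are told apart by a spoke. If \<open>u\<close>
  and \<open>v\<close> lie in different triangles, \<open>v\<close> has a single neighbour in the
  triangle of \<open>u\<close>, so some other vertex there is adjacent to \<open>u\<close>
  only.\<close>

lemma tww_dual_bipyramid: "tww (dual_mgraph bipyramid_verts bipyramid_edges) \<noteq> 0"
proof (rule tww_neq_0_if_no_twins)
  show "is_trigraph (trigraph_of (dual_mgraph bipyramid_verts bipyramid_edges))"
    by (rule is_trigraph_trigraph_of[OF simple_mgraph_dual_bipyramid])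
  show "2 \<le> card (verts (dual_mgraph bipyramid_verts bipyramid_edges))"
    by (simp add: dual_bipyramid_simps bipyramid_faces_def face_neqs)
qed (unfold dual_bipyramid_simps ends_dual_bipyramid_image bipyramid_faces_def ball_simps bex_simps,
    simp add: doubleton_eq_iff face_neqs face_neqs[symmetric])

theorem theorem1p3:
  "\<exists>V E. (V, E) \<in> simple_dual_class \<and> tww (plane_mgraph V E) \<noteq> tww (dual_mgraph V E)"
proof (intro exI conjI)
  show "(bipyramid_verts, bipyramid_edges) \<in> simple_dual_class"
    unfolding simple_dual_class_def
    using plane_graph_bipyramid simple_mgraph_bipyramid connected_mgraph_bipyramid
      simple_mgraph_dual_bipyramid connected_mgraph_dual_bipyramid planar_mgraph_dual_bipyramid
    by blast
  show "tww (plane_mgraph bipyramid_verts bipyramid_edges) \<noteq>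
      tww (dual_mgraph bipyramid_verts bipyramid_edges)"
    using tww_bipyramid tww_dual_bipyramid by simp
qed

end
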